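(* Let $a\in[0,1)$. Then the set of functions $\{\tilde e_k\}_{k\in\mathbb{Z}}$ is an orthonormal basis for $L^2([0,1])$.
   Context: $L^2([0,1])$ is the space of complex-valued square-integrable functions on $[0,1]$ with inner product $\langle f,g\rangle=\int_0^1 f(x)\overline{g(x)}\,dx$; "orthonormal basis" means complete orthonormal system. For a fixed real $a\in[0,1)$ and $k\in\mathbb{Z}$, the functions $\tilde e_k$ are defined by (with $a^0=1$, also when $a=0$) $$\tilde e_k(x)=\begin{cases}1 & \text{if } k=0,\\ \sqrt{1-a^2}\,\sum_{m=0}^{\infty}a^m e^{2\pi i k 2^m x} & \text{if } k \text{ is odd},\\ (1-a^2)\sum_{m=0}^{\infty}a^m e^{2\pi i k 2^m x}-a\,e^{\pi i k x} & \text{if } k \text{ is even and } k\neq 0.\end{cases}$$ *)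

theory Defs
  imports "HOL-Analysis.Analysis"
begin

text \<open>
  Elements of \<open>L\<^sup>2([0,1])\<close> are represented by functions; equality in the space is equality
  almost everywhere on \<open>[0,1]\<close>, and values outside \<open>[0,1]\<close> are irrelevant.
\<close>

definition L2 :: "(real \<Rightarrow> complex) set" where
  "L2 = {f. f \<in> borel_measurable (lebesgue_on {0..1}) \<and>
            integrable (lebesgue_on {0..1}) (\<lambda>x. (cmod (f x))\<^sup>2)}"

definition L2_inner :: "(real \<Rightarrow> complex) \<Rightarrow> (real \<Rightarrow> complex) \<Rightarrow> complex" where
  "L2_inner f g = (LINT x|lebesgue_on {0..1}. f x * cnj (g x))"

definition L2_norm :: "(real \<Rightarrow> complex) \<Rightarrow> real" where
  "L2_norm f = sqrt (LINT x|lebesgue_on {0..1}. (cmod (f x))\<^sup>2)"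

definition orthonormal_L2 :: "('i \<Rightarrow> real \<Rightarrow> complex) \<Rightarrow> bool" where
  "orthonormal_L2 e \<longleftrightarrow>
     (\<forall>j. e j \<in> L2) \<and> (\<forall>j k. L2_inner (e j) (e k) = (if j = k then 1 else 0))"

text \<open>Completeness of a system: its finite linear combinations are dense in \<open>L\<^sup>2([0,1])\<close>.\<close>

definition complete_L2 :: "('i \<Rightarrow> real \<Rightarrow> complex) \<Rightarrow> bool" where
  "complete_L2 e \<longleftrightarrow>
     (\<forall>f\<in>L2. \<forall>\<epsilon>>0. \<exists>F c. finite F \<and> L2_norm (\<lambda>x. f x - (\<Sum>k\<in>F. c k * e k x)) < \<epsilon>)"

definition orthonormal_basis_L2 :: "('i \<Rightarrow> real \<Rightarrow> complex) \<Rightarrow> bool" where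
  "orthonormal_basis_L2 e \<longleftrightarrow> orthonormal_L2 e \<and> complete_L2 e"

text \<open>
  Since \<open>\<bar>a\<bar> < 1\<close> in every use, the series converges absolutely and uniformly in \<open>x\<close>, so
  its pointwise sum agrees with its sum in \<open>L\<^sup>2([0,1])\<close>.
\<close>

definition e_tilde :: "real \<Rightarrow> int \<Rightarrow> real \<Rightarrow> complex" where
  "e_tilde a k x =
     (if k = 0 then 1
      else if odd k then
        of_real (sqrt (1 - a\<^sup>2)) *
          (\<Sum>m. of_real a ^ m * exp (2 * of_real pi * \<i> * of_int k * 2 ^ m * of_real x))
      else
        of_real (1 - a\<^sup>2) *
          (\<Sum>m. of_real a ^ m * exp (2 * of_real pi * \<i> * of_int k * 2 ^ m * of_real x))
        - of_real a * exp (of_real pi * \<i> * of_int k * of_real x))"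

end

theory Submission
  imports Defs
begin

text \<open>
  Write \<open>z k\<close> for the character \<open>x \<mapsto> exp (2\<pi>ikx)\<close>, \<open>T f\<close> for \<open>x \<mapsto> f (2x)\<close>, and \<open>S k\<close> for the series
  \<open>\<Sum>m. a\<^sup>m T\<^sup>m (z k)\<close>, so that \<open>(1 - aT) (S k) = z k\<close>. The even members of the system, including the
  constant one, are \<open>e (2k) = (T - a) (S k)\<close>, and the odd ones are \<open>e k = \<surd>(1 - a\<^sup>2) S k\<close>. As \<open>T\<close> is
  an isometry, \<open>(T - a) (S j)\<close> and \<open>(T - a) (S k)\<close> have the same inner product as \<open>(1 - aT) (S j) = z j\<close>
  and \<open>(1 - aT) (S k) = z k\<close>; the cases with an odd index use that \<open>z j\<close> is orthogonal to the range
  of \<open>T\<close> for odd \<open>j\<close>. By induction on \<open>\<bar>k\<bar>\<close> every \<open>S k\<close>, hence every \<open>z k = S k - a S (2k)\<close>, is a finite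
  linear combination of the system, so completeness reduces to the density of trigonometric
  polynomials, which follows from the Stone-Weierstrass theorem on the circle.
\<close>

section \<open>Characters and the inner product of continuous functions\<close>

definition trig_char :: "int \<Rightarrow> real \<Rightarrow> complex" where
  "trig_char k x = exp (2 * of_real pi * \<i> * of_int k * of_real x)"

text \<open>The series \<open>S k\<close> of the overview. As \<open>T\<close> doubles frequencies,
  \<open>T^m\<close> sends \<open>trig_char k\<close> to \<open>trig_char (k * 2 ^ m)\<close>, and
  \<open>T (S k)\<close> is \<open>lacunary a (2 * k)\<close>.\<close>

definition lacunary :: "real \<Rightarrow> int \<Rightarrow> real \<Rightarrow> complex" where
  "lacunary a k x = (\<Sum>m. of_real a ^ m * trig_char (k * 2 ^ m) x)"

lemma norm_trig_char [simp]: "cmod (trig_char k x) = 1"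
  by (simp add: trig_char_def)

lemma trig_char_0 [simp]: "trig_char 0 = (\<lambda>x. 1)"
  by (simp add: trig_char_def fun_eq_iff)

lemma trig_char_add: "trig_char (j + k) x = trig_char j x * trig_char k x"
  by (simp add: trig_char_def algebra_simps flip: exp_add)

lemma cnj_trig_char: "cnj (trig_char k x) = trig_char (- k) x"
  by (simp add: trig_char_def exp_cnj)

lemma continuous_on_trig_char [continuous_intros]: "continuous_on A (trig_char k)"
  unfolding trig_char_def by (intro continuous_intros)

lemma L2_inner_cnj: "L2_inner g f = cnj (L2_inner f g)"
  unfolding L2_inner_def by (subst Bochner_Integration.integral_cnj[symmetric]) (simp add: mult.commute)

lemma L2_inner_scale_left: "L2_inner (\<lambda>x. c * f x) g = c * L2_inner f g"
  by (simp add: L2_inner_def mult.assoc)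

lemma L2_inner_scale_right: "L2_inner f (\<lambda>x. c * g x) = cnj c * L2_inner f g"
  by (metis L2_inner_cnj L2_inner_scale_left complex_cnj_mult)

text \<open>Continuity is the form in which integrability of both products is supplied; all
  functions in the orthonormality argument are continuous.\<close>

lemma L2_inner_lincomb_left:
  assumes "continuous_on {0..1} f" "continuous_on {0..1} g" "continuous_on {0..1} h"
  shows "L2_inner (\<lambda>x. f x + c * g x) h = L2_inner f h + c * L2_inner g h"
proof -
  have "integrable (lebesgue_on {0..1}) (\<lambda>x. f x * cnj (h x))"
       "integrable (lebesgue_on {0..1}) (\<lambda>x. c * g x * cnj (h x))"
    by (intro continuous_imp_integrable_real continuous_intros assms)+
  then have "L2_inner (\<lambda>x. f x + c * g x) h = L2_inner f h + L2_inner (\<lambda>x. c * g x) h"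
    by (simp add: L2_inner_def distrib_right)
  then show ?thesis
    by (simp only: L2_inner_scale_left)
qed

lemma L2_inner_lincomb_right:
  assumes "continuous_on {0..1} f" "continuous_on {0..1} g" "continuous_on {0..1} h"
  shows "L2_inner h (\<lambda>x. f x + c * g x) = L2_inner h f + cnj c * L2_inner h g"
proof -
  have "L2_inner h (\<lambda>x. f x + c * g x) = cnj (L2_inner f h + c * L2_inner g h)"
    by (subst L2_inner_cnj) (simp only: L2_inner_lincomb_left[OF assms])
  then show ?thesis
    by (simp add: L2_inner_cnj[of f h] L2_inner_cnj[of g h])
qed

lemma L2_inner_trig_char: "L2_inner (trig_char j) (trig_char k) = (if j = k then 1 else 0)"
proof -
  have eq: "L2_inner (trig_char j) (trig_char k) = integral {0..1} (trig_char (j - k))"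
    unfolding L2_inner_def cnj_trig_char trig_char_add[symmetric]
    by (simp add: lebesgue_integral_eq_integral continuous_imp_integrable_real
          continuous_on_trig_char)
  show ?thesis
  proof (cases "j = k")
    case True
    then show ?thesis unfolding eq by simp
  next
    case False
    define w where "w = 2 * of_real pi * \<i> * of_int (j - k)"
    have w: "w \<noteq> 0" using False by (simp add: w_def)
    \<comment> \<open>This makes the antiderivative \<open>exp (w * x) / w\<close> agree at 0 and 1,
      so the integral vanishes.\<close>
    have "exp w = 1"
      unfolding w_def exp_eq_1 by (auto intro: exI[of _ "j - k"])
    have "((\<lambda>x. exp (w * of_real x) / w) has_vector_derivative exp (w * of_real x))
            (at x within {0..1})" for x :: real
      by (rule has_vector_derivative_real_field) (use w in \<open>auto intro!: derivative_eq_intros\<close>)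
    then have "((\<lambda>x. exp (w * of_real x)) has_integral
            exp (w * of_real 1) / w - exp (w * of_real 0) / w) {0..1}"
      by (intro fundamental_theorem_of_calculus) auto
    then have "(trig_char (j - k) has_integral 0) {0..1}"
      unfolding trig_char_def[abs_def] w_def[symmetric] by (simp add: \<open>exp w = 1\<close>)
    then show ?thesis using False eq by (simp add: integral_unique)
  qed
qed

section \<open>The lacunary series and orthonormality of the system\<close>

context
  fixes a :: real
  assumes a: "\<bar>a\<bar> < 1"
begin

lemma summable_abs_power: "summable (\<lambda>m. \<bar>a\<bar> ^ m)"
  by (rule summable_geometric) (use a in simp)

lemma norm_lacunary_term: "cmod (of_real a ^ m * trig_char k x) = \<bar>a\<bar> ^ m"
  by (simp add: norm_mult norm_power)

lemma summable_lacunary: "summable (\<lambda>m. of_real a ^ m * trig_char (k * 2 ^ m) x)"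
  by (rule summable_norm_cancel) (simp only: norm_lacunary_term summable_abs_power)

text \<open>The identity \<open>(1 - aT) (S k) = z k\<close>: the term \<open>m = 0\<close> is split
  off, and a factor \<open>a\<close> is taken out of the rest.\<close>

lemma lacunary_unfold: "lacunary a k x = trig_char k x + of_real a * lacunary a (2 * k) x"
proof -
  have "(\<Sum>m. of_real a ^ Suc m * trig_char (k * 2 ^ Suc m) x) = of_real a * lacunary a (2 * k) x"
    unfolding lacunary_def by (subst suminf_mult[symmetric, OF summable_lacunary])
      (simp add: mult.assoc mult.commute mult.left_commute)
  then show ?thesis
    unfolding lacunary_def using suminf_split_head[OF summable_lacunary, of k x] by simp
qed

lemma continuous_on_lacunary: "continuous_on A (lacunary a k)"
proof (rule uniform_limit_theorem)
  show "uniform_limit A (\<lambda>n x. \<Sum>m<n. of_real a ^ m * trig_char (k * 2 ^ m) x)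
          (lacunary a k) sequentially"
    unfolding lacunary_def
    by (rule Weierstrass_m_test[OF _ summable_abs_power]) (simp add: norm_lacunary_term)
  show "\<forall>\<^sub>F n in sequentially.
          continuous_on A (\<lambda>x. \<Sum>m<n. of_real a ^ m * trig_char (k * 2 ^ m) x)"
    by (intro always_eventually allI continuous_intros)
qed simp

text \<open>Sum and integral may be exchanged because the m-th term is bounded by
  \<open>\<bar>a\<bar> ^ m * cmod (g x)\<close>, which is summable both pointwise and after
  integration.\<close>

lemma L2_inner_lacunary_left:
  assumes g: "continuous_on {0..1} g"
  shows "L2_inner (lacunary a k) g = (\<Sum>m. of_real a ^ m * L2_inner (trig_char (k * 2 ^ m)) g)"
proof -
  let ?M = "lebesgue_on {0..1::real}"
  let ?f = "\<lambda>m x. of_real a ^ m * trig_char (k * 2 ^ m) x * cnj (g x)"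
  have norm_f: "cmod (?f m x) = \<bar>a\<bar> ^ m * cmod (g x)" for m x
    by (simp add: norm_mult norm_power)
  have "(\<integral>x. (\<Sum>m. ?f m x) \<partial>?M) = (\<Sum>m. integral\<^sup>L ?M (?f m))"
  proof (rule integral_suminf)
    show "integrable ?M (?f m)" for m
      by (intro continuous_imp_integrable_real continuous_intros g)
    show "AE x in ?M. summable (\<lambda>m. norm (?f m x))"
      unfolding norm_f by (intro AE_I2 summable_mult2 summable_abs_power)
    show "summable (\<lambda>m. \<integral>x. norm (?f m x) \<partial>?M)"
      unfolding norm_f by (simp add: summable_mult2[OF summable_abs_power])
  qed
  moreover have "(\<Sum>m. ?f m x) = lacunary a k x * cnj (g x)" for x
    unfolding lacunary_def by (rule suminf_mult2[symmetric, OF summable_lacunary])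
  moreover have "integral\<^sup>L ?M (?f m) = of_real a ^ m * L2_inner (trig_char (k * 2 ^ m)) g" for m
    by (simp add: L2_inner_def mult.assoc)
  ultimately show ?thesis
    by (simp add: L2_inner_def)
qed

text \<open>The series stays unevaluated: for \<open>k \<noteq> 0\<close> at most one term survives,
  but for \<open>j = k = 0\<close> all of them do, and this form covers both cases.\<close>

lemma L2_inner_trig_char_lacunary:
  "L2_inner (trig_char j) (lacunary a k) = cnj (\<Sum>m. of_real a ^ m * (if k * 2 ^ m = j then 1 else 0))"
  by (subst L2_inner_cnj) (simp only: L2_inner_lacunary_left[OF continuous_on_trig_char] L2_inner_trig_char)

text \<open>The isometry property of \<open>T\<close>. The inner product depends only on which
  frequencies \<open>j * 2 ^ m\<close> and \<open>k * 2 ^ n\<close> coincide, and doubling both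
  sides preserves these coincidences.\<close>

lemma L2_inner_lacunary_double:
  "L2_inner (lacunary a (2 * j)) (lacunary a (2 * k)) = L2_inner (lacunary a j) (lacunary a k)"
  by (simp add: L2_inner_lacunary_left continuous_on_lacunary L2_inner_trig_char_lacunary mult.assoc)

lemma L2_inner_trig_char_lacunary_odd:
  assumes "odd j"
  shows "L2_inner (trig_char j) (lacunary a (2 * k)) = 0"
proof -
  have "2 * k * 2 ^ m \<noteq> j" for m
    using assms by auto
  then show ?thesis
    by (simp add: L2_inner_trig_char_lacunary)
qed

lemma e_tilde_odd: "odd k \<Longrightarrow> e_tilde a k = (\<lambda>x. of_real (sqrt (1 - a\<^sup>2)) * lacunary a k x)"
  by (auto simp: e_tilde_def lacunary_def trig_char_def fun_eq_iff mult.assoc)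

lemma e_tilde_even: "e_tilde a (2 * k) = (\<lambda>x. lacunary a (2 * k) x - of_real a * lacunary a k x)"
proof (rule ext)
  fix x
  show "e_tilde a (2 * k) x = lacunary a (2 * k) x - of_real a * lacunary a k x"
  proof (cases "k = 0")
    case True
    then show ?thesis
      \<comment> \<open>At \<open>k = 0\<close> the unfolding reads
        \<open>S 0 = 1 + a * S 0\<close>, so the constant 1 is \<open>(1 - a) * S 0\<close> and fits
        the even pattern.\<close>
      using lacunary_unfold[of 0 x] by (simp add: e_tilde_def algebra_simps)
  next
    case False
    have "e_tilde a (2 * k) x = of_real (1 - a\<^sup>2) * lacunary a (2 * k) x - of_real a * trig_char k x"
      using False by (simp add: e_tilde_def lacunary_def trig_char_def mult_ac)
    then show ?thesis
      \<comment> \<open>Unfolding \<open>S k\<close> on the right yields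
        \<open>z k + a * S (2k)\<close>; the coefficient of \<open>S (2k)\<close> then becomes
        \<open>1 - a^2\<close>.\<close>
      by (subst lacunary_unfold[of k]) (simp add: algebra_simps power2_eq_square)
  qed
qed

lemma continuous_on_e_tilde: "continuous_on A (e_tilde a k)"
  by (cases "even k")
    (auto elim!: evenE simp: e_tilde_even e_tilde_odd intro!: continuous_intros continuous_on_lacunary)

lemmas lincomb_continuous = continuous_on_add continuous_on_mult_left
  continuous_on_lacunary continuous_on_trig_char

text \<open>One expansion serving both \<open>(T - a) (S k)\<close> and
  \<open>(1 - aT) (S k)\<close>, which differ only in the order of \<open>k\<close> and
  \<open>2 * k\<close>.\<close>

lemma L2_inner_lacunary_lincomb:
  "L2_inner (\<lambda>x. lacunary a p x + b * lacunary a q x) (\<lambda>x. lacunary a r x + c * lacunary a s x)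
    = L2_inner (lacunary a p) (lacunary a r) + cnj c * L2_inner (lacunary a p) (lacunary a s)
      + b * (L2_inner (lacunary a q) (lacunary a r) + cnj c * L2_inner (lacunary a q) (lacunary a s))"
  by (simp only: L2_inner_lincomb_left L2_inner_lincomb_right lincomb_continuous)

lemma trig_char_conv_lacunary:
  "trig_char k = (\<lambda>x. lacunary a k x + of_real (- a) * lacunary a (2 * k) x)"
  by (rule ext, subst lacunary_unfold[of k]) simp

lemma L2_inner_e_tilde_even:
  "L2_inner (e_tilde a (2 * j)) (e_tilde a (2 * k)) = (if j = k then 1 else 0)"
proof -
  let ?S = "lacunary a"
  have e: "e_tilde a (2 * k) = (\<lambda>x. ?S (2 * k) x + of_real (- a) * ?S k x)" for k
    by (simp add: e_tilde_even)
  \<comment> \<open>The mixed terms are the same on both sides; the diagonal ones are exchanged, and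
    agree by invariance under doubling.\<close>
  have "L2_inner (e_tilde a (2 * j)) (e_tilde a (2 * k)) = L2_inner (trig_char j) (trig_char k)"
    unfolding e trig_char_conv_lacunary L2_inner_lacunary_lincomb L2_inner_lacunary_double
    by (simp add: algebra_simps)
  then show ?thesis
    by (simp add: L2_inner_trig_char)
qed

lemma L2_inner_e_tilde_odd_even:
  assumes "odd j"
  shows "L2_inner (e_tilde a j) (e_tilde a (2 * k)) = 0"
proof -
  let ?S = "lacunary a"
  have e: "e_tilde a (2 * k) = (\<lambda>x. ?S (2 * k) x + of_real (- a) * ?S k x)" for k
    by (simp add: e_tilde_even)
  have S: "?S j = (\<lambda>x. trig_char j x + of_real a * ?S (2 * j) x)"
    by (rule ext) (rule lacunary_unfold)
  have "L2_inner (?S j) (?S (2 * k))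
      = L2_inner (trig_char j) (?S (2 * k)) + of_real a * L2_inner (?S (2 * j)) (?S (2 * k))"
    by (subst S) (simp only: L2_inner_lincomb_left lincomb_continuous)
  \<comment> \<open>Since \<open>z j\<close> is orthogonal to \<open>S (2k)\<close>, only the tail
    of \<open>S j\<close> contributes. The value is exactly what the term \<open>- a * S k\<close>
    of the even member cancels.\<close>
  then have "L2_inner (?S j) (?S (2 * k)) = of_real a * L2_inner (?S j) (?S k)"
    by (simp add: L2_inner_trig_char_lacunary_odd[OF assms] L2_inner_lacunary_double)
  moreover have "L2_inner (?S j) (e_tilde a (2 * k))
      = L2_inner (?S j) (?S (2 * k)) + of_real (- a) * L2_inner (?S j) (?S k)"
    unfolding e by (simp add: L2_inner_lincomb_right lincomb_continuous del: of_real_minus mult_minus_left)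
  ultimately show ?thesis
    by (simp add: e_tilde_odd[OF assms] L2_inner_scale_left)
qed

lemma L2_inner_e_tilde_odd:
  assumes "odd j" "odd k"
  shows "L2_inner (e_tilde a j) (e_tilde a k) = (if j = k then 1 else 0)"
proof -
  let ?S = "lacunary a"
  have S: "?S j = (\<lambda>x. trig_char j x + of_real a * ?S (2 * j) x)" for j
    by (rule ext) (rule lacunary_unfold)
  have eq: "L2_inner (?S j) (?S k)
      = L2_inner (trig_char j) (trig_char k) + of_real a * L2_inner (trig_char j) (?S (2 * k))
        + of_real a * (L2_inner (?S (2 * j)) (trig_char k)
          + of_real a * L2_inner (?S (2 * j)) (?S (2 * k)))"
    by (subst S[of j], subst S[of k])
      (simp only: L2_inner_lincomb_left L2_inner_lincomb_right lincomb_continuous complex_cnj_complex_of_real)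
  \<comment> \<open>Both mixed terms in \<open>eq\<close> vanish by parity, so
    \<open>h = L2_inner (S j) (S k)\<close> satisfies a linear equation with itself on the right.
    Its factor \<open>1 - a^2\<close> is the product of the two normalising square roots.\<close>
  have self: "of_real (1 - a\<^sup>2) * h = d" if "h = d + of_real a * (of_real a * h)" for h d :: complex
  proof -
    have "of_real (1 - a\<^sup>2) * h = h - of_real a * (of_real a * h)"
      by (simp add: algebra_simps power2_eq_square)
    also have "\<dots> = d"
      unfolding diff_eq_eq by (rule that)
    finally show ?thesis .
  qed
  have "L2_inner (?S (2 * j)) (trig_char k) = 0"
    by (subst L2_inner_cnj) (simp add: L2_inner_trig_char_lacunary_odd[OF assms(2)])
  then have "L2_inner (?S j) (?S k)
      = (if j = k then 1 else 0) + of_real a * (of_real a * L2_inner (?S j) (?S k))"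
    by (intro trans[OF eq])
      (simp add: L2_inner_trig_char_lacunary_odd[OF assms(1)] L2_inner_lacunary_double
        L2_inner_trig_char)
  then have "of_real (1 - a\<^sup>2) * L2_inner (?S j) (?S k) = (if j = k then 1 else 0)"
    by (rule self)
  moreover have "of_real (sqrt (1 - a\<^sup>2)) * of_real (sqrt (1 - a\<^sup>2)) = (of_real (1 - a\<^sup>2) :: complex)"
    using a by (simp add: abs_square_le_1 flip: of_real_mult)
  ultimately show ?thesis
    by (simp add: e_tilde_odd assms L2_inner_scale_left L2_inner_scale_right flip: mult.assoc)
qed

lemma L2_inner_e_tilde: "L2_inner (e_tilde a j) (e_tilde a k) = (if j = k then 1 else 0)"
proof -
  consider (ee) j' k' where "j = 2 * j'" "k = 2 * k'" | (oo) "odd j" "odd k"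
    | (oe) k' where "odd j" "k = 2 * k'" | (eo) j' where "j = 2 * j'" "odd k"
    by (meson evenE)
  then show ?thesis
  proof cases
    case ee
    then show ?thesis by (simp add: L2_inner_e_tilde_even)
  next
    case oo
    then show ?thesis by (simp add: L2_inner_e_tilde_odd)
  next
    case oe
    then show ?thesis by (auto simp: L2_inner_e_tilde_odd_even)
  next
    case eo
    then show ?thesis by (subst L2_inner_cnj) (auto simp: L2_inner_e_tilde_odd_even)
  qed
qed

end

lemma continuous_imp_L2:
  assumes "continuous_on {0..1} f"
  shows "f \<in> L2"
  unfolding L2_def
  by (auto intro!: borel_measurable_integrable continuous_imp_integrable_real continuous_intros assms)

lemma orthonormal_e_tilde: "\<bar>a\<bar> < 1 \<Longrightarrow> orthonormal_L2 (e_tilde a)"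
  by (simp add: orthonormal_L2_def L2_inner_e_tilde continuous_imp_L2 continuous_on_e_tilde)

section \<open>Finite linear combinations\<close>

definition lin_combs :: "('i \<Rightarrow> real \<Rightarrow> complex) \<Rightarrow> (real \<Rightarrow> complex) set" where
  "lin_combs e = {f. \<exists>F c. finite F \<and> f = (\<lambda>x. \<Sum>k\<in>F. c k * e k x)}"

lemma lin_combs_zero: "(\<lambda>x. 0) \<in> lin_combs e"
  unfolding lin_combs_def by (auto intro!: exI[of _ "{}"])

lemma lin_combs_basis: "e k \<in> lin_combs e"
  unfolding lin_combs_def by (auto intro!: exI[of _ "{k}"] exI[of _ "\<lambda>_. 1"])

lemma lin_combs_scale:
  assumes "f \<in> lin_combs e"
  shows "(\<lambda>x. b * f x) \<in> lin_combs e"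
proof -
  obtain F c where "finite F" "f = (\<lambda>x. \<Sum>k\<in>F. c k * e k x)"
    using assms by (auto simp: lin_combs_def)
  then show ?thesis
    unfolding lin_combs_def
    by (auto intro!: exI[of _ F] exI[of _ "\<lambda>k. b * c k"] simp: sum_distrib_left mult.assoc)
qed

lemma lin_combs_add:
  assumes "f \<in> lin_combs e" "g \<in> lin_combs e"
  shows "(\<lambda>x. f x + g x) \<in> lin_combs e"
proof -
  obtain F c where F: "finite F" "f = (\<lambda>x. \<Sum>k\<in>F. c k * e k x)"
    using assms(1) by (auto simp: lin_combs_def)
  obtain G d where G: "finite G" "g = (\<lambda>x. \<Sum>k\<in>G. d k * e k x)"
    using assms(2) by (auto simp: lin_combs_def)
  \<comment> \<open>Extending the coefficients by 0 puts both sums over the common index set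
    \<open>F \<union> G\<close>.\<close>
  define c' where "c' k = (if k \<in> F then c k else 0)" for k
  define d' where "d' k = (if k \<in> G then d k else 0)" for k
  have "f x = (\<Sum>k\<in>F \<union> G. c' k * e k x)" "g x = (\<Sum>k\<in>F \<union> G. d' k * e k x)" for x
    unfolding F(2) G(2) c'_def d'_def using F(1) G(1) by (auto intro!: sum.mono_neutral_cong_left)
  then have "(\<lambda>x. f x + g x) = (\<lambda>x. \<Sum>k\<in>F \<union> G. (c' k + d' k) * e k x)"
    by (simp add: distrib_right sum.distrib)
  then show ?thesis
    unfolding lin_combs_def using F(1) G(1)
    by (intro CollectI exI[of _ "F \<union> G"] exI[of _ "\<lambda>k. c' k + d' k"]) simp
qed

lemma lin_combs_sum:
  "(\<And>i. i \<in> I \<Longrightarrow> g i \<in> lin_combs e) \<Longrightarrow> (\<lambda>x. \<Sum>i\<in>I. g i x) \<in> lin_combs e"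
proof (induction I rule: infinite_finite_induct)
  case (insert i I)
  then show ?case by (simp add: lin_combs_add)
\<comment> \<open>Over an infinite \<open>I\<close> the sum is 0 by convention, as over the empty
  set.\<close>
qed (simp_all add: lin_combs_zero)

lemma lin_combs_trans:
  assumes "f \<in> lin_combs e" "\<And>k. e k \<in> lin_combs e'"
  shows "f \<in> lin_combs e'"
proof -
  obtain F c where "f = (\<lambda>x. \<Sum>k\<in>F. c k * e k x)"
    using assms(1) by (auto simp: lin_combs_def)
  then show ?thesis
    by (simp only:) (intro lin_combs_sum lin_combs_scale assms(2))
qed

lemma continuous_on_lin_combs:
  assumes "f \<in> lin_combs e" "\<And>k. continuous_on A (e k)"
  shows "continuous_on A f"
proof -
  obtain F c where "f = (\<lambda>x. \<Sum>k\<in>F. c k * e k x)"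
    using assms(1) by (auto simp: lin_combs_def)
  then show ?thesis
    by (simp only:) (intro continuous_on_sum continuous_on_mult_left assms(2))
qed

section \<open>Uniform approximation by trigonometric polynomials\<close>

lemma lin_combs_trig_char_mult:
  assumes f: "f \<in> lin_combs trig_char" and g: "g \<in> lin_combs trig_char"
  shows "(\<lambda>x. f x * g x) \<in> lin_combs trig_char"
proof -
  have shift: "(\<lambda>x. trig_char k x * g x) \<in> lin_combs trig_char" for k
  proof -
    obtain G d where G: "g = (\<lambda>x. \<Sum>j\<in>G. d j * trig_char j x)"
      using g by (auto simp: lin_combs_def)
    have "(\<lambda>x. trig_char k x * g x) = (\<lambda>x. \<Sum>j\<in>G. d j * trig_char (k + j) x)"
      unfolding G trig_char_add sum_distrib_left by (simp only: mult.left_commute)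
    also have "\<dots> \<in> lin_combs trig_char"
      by (intro lin_combs_sum lin_combs_scale lin_combs_basis)
    finally show ?thesis .
  qed
  obtain F c where "f = (\<lambda>x. \<Sum>k\<in>F. c k * trig_char k x)"
    using f by (auto simp: lin_combs_def)
  then have "(\<lambda>x. f x * g x) = (\<lambda>x. \<Sum>k\<in>F. c k * (trig_char k x * g x))"
    by (simp add: sum_distrib_right mult.assoc)
  also have "\<dots> \<in> lin_combs trig_char"
    by (intro lin_combs_sum lin_combs_scale shift)
  finally show ?thesis .
qed

text \<open>Turns the polynomials of Stone-Weierstrass into trigonometric ones: on the unit circle
  \<open>cnj w\<close> is the character of frequency -1, and the products are handled by closure
  under multiplication.\<close>

lemma real_polynomial_trig_char:
  "real_polynomial_function p \<Longrightarrow> (\<lambda>x. of_real (p (trig_char 1 x))) \<in> lin_combs trig_char"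
proof (induction p rule: real_polynomial_function.induct)
  case (linear f)
  interpret bounded_linear f by fact
  have f_eq: "f w = Re w * f 1 + Im w * f \<i>" for w
  proof -
    have "f w = f (Re w *\<^sub>R 1 + Im w *\<^sub>R \<i>)"
      by (rule arg_cong[of _ _ f]) (simp add: complex_eq_iff)
    also have "\<dots> = Re w * f 1 + Im w * f \<i>"
      by (simp only: add scale real_scaleR_def)
    finally show ?thesis .
  qed
  \<comment> \<open>A real-linear functional on the plane is a complex combination of
    \<open>w\<close> and \<open>cnj w\<close>; substitute \<open>Re w = (w + cnj w) / 2\<close> and
    \<open>Im w = (w - cnj w) / (2 * \<i>)\<close>.\<close>
  have eq: "of_real (f w) = (f 1 - \<i> * f \<i>) / 2 * w + (f 1 + \<i> * f \<i>) / 2 * cnj w" for w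
    by (subst f_eq[of w]) (simp add: complex_eq_iff field_simps)
  show ?case
    by (subst eq, subst cnj_trig_char) (intro lin_combs_add lin_combs_scale lin_combs_basis)
next
  case (const c)
  then show ?case
    using lin_combs_scale[OF lin_combs_basis[of trig_char 0], of "of_real c"] by simp
next
  case (add f g)
  then show ?case by (simp add: lin_combs_add)
next
  case (mult f g)
  then show ?case by (simp add: lin_combs_trig_char_mult)
qed

text \<open>Ensures that a function with equal values at 0 and 1 descends to the circle: two points
  of the interval differ by an integer only if they coincide or are the two endpoints.\<close>

lemma trig_char_1_eqD:
  assumes "x \<in> {0..1}" "y \<in> {0..1}" "trig_char 1 x = trig_char 1 y"
  shows "x = y \<or> {x, y} = {0, 1}"
proof -
  have "exp (\<i> * of_real (2 * pi * x)) = exp (\<i> * of_real (2 * pi * y))"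
    using assms(3) by (simp add: trig_char_def mult_ac)
  then obtain n :: int where "\<i> * of_real (2 * pi * x) = \<i> * of_real (2 * pi * y) + of_int (2 * n) * pi * \<i>"
    unfolding exp_eq by auto
  then have "of_real (2 * pi * x) = (of_real (2 * pi * (y + of_int n)) :: complex)"
    by (simp add: complex_eq_iff algebra_simps)
  then have n: "x = y + of_int n"
    unfolding of_real_eq_iff by simp
  then have "\<bar>of_int n :: real\<bar> \<le> 1"
    using assms by auto
  then have "\<bar>n\<bar> \<le> 1" by linarith
  then have "n = 0 \<or> n = 1 \<or> n = -1" by linarith
  then show ?thesis
    using n assms by auto
qed

text \<open>A continuous map from a compact space to a Hausdorff space is closed, hence a quotient
  map onto its image. Here the preimage of a closed set under \<open>H\<close> is the image of a
  compact set.\<close>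

lemma continuous_on_factor_compact:
  fixes p :: "'a::topological_space \<Rightarrow> 'b::t2_space" and H :: "'b \<Rightarrow> 'c::topological_space"
  assumes S: "compact S" and p: "continuous_on S p" and Hp: "continuous_on S (H \<circ> p)"
  shows "continuous_on (p ` S) H"
proof -
  have "closed (H -` B \<inter> p ` S)" if "closed B" for B
  proof -
    obtain C where C: "closed C" "C \<inter> S = (H \<circ> p) -` B \<inter> S"
      using Hp \<open>closed B\<close> unfolding continuous_on_closed_invariant by blast
    have "H -` B \<inter> p ` S = p ` (C \<inter> S)"
      unfolding C(2) by auto
    moreover have "compact (p ` (C \<inter> S))"
      by (intro compact_continuous_image continuous_on_subset[OF p] closed_Int_compact C S) auto
    ultimately show ?thesis
      by (simp add: compact_imp_closed)
  qed
  then show ?thesis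
    using compact_imp_closed[OF compact_continuous_image[OF p S]]
    by (simp add: continuous_on_closed_vimage)
qed

lemma trig_uniform_approx:
  assumes h: "continuous_on {0..1} h" "h 0 = h 1" and e: "e > 0"
  obtains p where "p \<in> lin_combs trig_char" "\<And>x. x \<in> {0..1} \<Longrightarrow> cmod (h x - p x) < e"
proof -
  let ?z = "trig_char 1"
  \<comment> \<open>The chosen preimage is ambiguous only over the point 1 of the circle, where
    \<open>h 0 = h 1\<close> makes the choice harmless.\<close>
  define H where "H w = h (inv_into {0..1} ?z w)" for w
  have H: "H (?z x) = h x" if "x \<in> {0..1}" for x
  proof -
    let ?y = "inv_into {0..1} ?z (?z x)"
    have "?y \<in> {0..1}" "?z ?y = ?z x"
      using that by (auto intro!: inv_into_into f_inv_into_f simp del: atLeastAtMost_iff)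
    then have "?y = x \<or> {?y, x} = {0, 1}"
      using that by (intro trig_char_1_eqD)
    then show ?thesis
      using h(2) by (auto simp: H_def doubleton_eq_iff)
  qed
  have "continuous_on (?z ` {0..1}) H"
    by (intro continuous_on_factor_compact continuous_on_trig_char continuous_on_eq[OF h(1)])
      (auto simp: H)
  then obtain q where q: "polynomial_function q" "\<And>w. w \<in> ?z ` {0..1} \<Longrightarrow> cmod (H w - q w) < e"
    using Stone_Weierstrass_polynomial_function[of "?z ` {0..1}" H e] e
    by (metis compact_Icc compact_continuous_image continuous_on_trig_char)
  \<comment> \<open>Stone-Weierstrass gives a complex-valued \<open>q\<close> that is polynomial
    over the reals, so its real and imaginary parts are converted separately.\<close>
  have "real_polynomial_function (Re \<circ> q)" "real_polynomial_function (Im \<circ> q)"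
    using q(1) bounded_linear_Re bounded_linear_Im by (auto simp: polynomial_function_def)
  then have "(\<lambda>x. of_real (Re (q (?z x))) + \<i> * of_real (Im (q (?z x)))) \<in> lin_combs trig_char"
    by (intro lin_combs_add lin_combs_scale) (auto dest: real_polynomial_trig_char)
  then have "(\<lambda>x. q (?z x)) \<in> lin_combs trig_char"
    by (simp flip: complex_eq)
  moreover have "cmod (h x - q (?z x)) < e" if "x \<in> {0..1}" for x
    using q(2)[of "?z x"] H[OF that] that by simp
  ultimately show ?thesis
    using that by blast
qed

section \<open>Approximation in the square-integral norm\<close>

lemma norm_add_square_le: "(cmod (u + v))\<^sup>2 \<le> 2 * (cmod u)\<^sup>2 + 2 * (cmod v)\<^sup>2"
proof -
  have "(cmod (u + v))\<^sup>2 \<le> (cmod u + cmod v)\<^sup>2"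
    by (simp add: norm_triangle_ineq power_mono)
  also have "\<dots> \<le> 2 * (cmod u)\<^sup>2 + 2 * (cmod v)\<^sup>2"
    using zero_le_power2[of "cmod u - cmod v"] by (simp add: power2_eq_square algebra_simps)
  finally show ?thesis .
qed

lemma L2_add:
  assumes "f \<in> L2" "g \<in> L2"
  shows "(\<lambda>x. f x + g x) \<in> L2"
proof -
  have [measurable]: "f \<in> borel_measurable (lebesgue_on {0..1})" "g \<in> borel_measurable (lebesgue_on {0..1})"
    using assms by (auto simp: L2_def)
  have "integrable (lebesgue_on {0..1}) (\<lambda>x. (cmod (f x + g x))\<^sup>2)"
  proof (rule Bochner_Integration.integrable_bound)
    show "integrable (lebesgue_on {0..1}) (\<lambda>x. 2 * (cmod (f x))\<^sup>2 + 2 * (cmod (g x))\<^sup>2)"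
      using assms by (auto simp: L2_def)
  qed (use norm_add_square_le in auto)
  then show ?thesis
    by (simp add: L2_def)
qed

lemma L2_diff:
  assumes "f \<in> L2" "g \<in> L2"
  shows "(\<lambda>x. f x - g x) \<in> L2"
proof -
  have "(\<lambda>x. - g x) \<in> L2"
    using assms(2) by (auto simp: L2_def)
  from L2_add[OF assms(1) this] show ?thesis by simp
qed

lemma bounded_imp_L2:
  assumes "f \<in> borel_measurable (lebesgue_on {0..1})" "\<And>x. cmod (f x) \<le> B"
  shows "f \<in> L2"
proof -
  interpret finite_measure "lebesgue_on {0..1::real}"
    by (rule finite_measure_lebesgue_on) simp
  have "integrable (lebesgue_on {0..1}) (\<lambda>x. (cmod (f x))\<^sup>2)"
    using assms by (intro integrable_const_bound[of _ "B\<^sup>2"]) (auto intro!: AE_I2 power_mono)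
  then show ?thesis
    using assms by (simp add: L2_def)
qed

lemma L2_norm_less_iff:
  "e > 0 \<Longrightarrow> L2_norm f < e \<longleftrightarrow> (LINT x|lebesgue_on {0..1}. (cmod (f x))\<^sup>2) < e\<^sup>2"
  by (metis L2_norm_def less_le real_sqrt_less_iff real_sqrt_unique)

text \<open>A replacement for Minkowski's inequality: with both norms below \<open>e / 2\<close>,
  the crude bound \<open>2 * (e/2)^2 + 2 * (e/2)^2\<close> is exactly \<open>e^2\<close>.\<close>

lemma L2_norm_add_less:
  assumes "f \<in> L2" "g \<in> L2" "L2_norm f < e / 2" "L2_norm g < e / 2" "e > 0"
  shows "L2_norm (\<lambda>x. f x + g x) < e"
proof -
  let ?I = "\<lambda>f. LINT x|lebesgue_on {0..1}. (cmod (f x))\<^sup>2"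
  have "?I (\<lambda>x. f x + g x) \<le> (LINT x|lebesgue_on {0..1}. 2 * (cmod (f x))\<^sup>2 + 2 * (cmod (g x))\<^sup>2)"
    using assms(1,2) L2_add[OF assms(1,2)] norm_add_square_le
    by (intro integral_mono) (auto simp: L2_def)
  also have "\<dots> = 2 * ?I f + 2 * ?I g"
    using assms(1,2) by (auto simp: L2_def)
  also have "\<dots> < e\<^sup>2"
    using assms L2_norm_less_iff[of "e / 2" f] L2_norm_less_iff[of "e / 2" g]
    by (simp add: power_divide)
  finally show ?thesis
    using \<open>e > 0\<close> by (simp add: L2_norm_less_iff)
qed

text \<open>Dominated convergence applied to the squared errors; both the truncation and the
  continuous approximation below rest on it.\<close>

lemma L2_norm_dominated:
  assumes [measurable]: "f \<in> borel_measurable (lebesgue_on {0..1})"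
      "\<And>n. u n \<in> borel_measurable (lebesgue_on {0..1})"
    and lim: "AE x in lebesgue_on {0..1}. (\<lambda>n. u n x) \<longlonglongrightarrow> f x"
    and w: "integrable (lebesgue_on {0..1}) w" "\<And>n x. (cmod (f x - u n x))\<^sup>2 \<le> w x"
    and e: "e > 0"
  obtains n where "L2_norm (\<lambda>x. f x - u n x) < e"
proof -
  let ?M = "lebesgue_on {0..1::real}"
  have "(\<lambda>n. LINT x|?M. (cmod (f x - u n x))\<^sup>2) \<longlonglongrightarrow> (LINT x|?M. 0)"
  proof (rule integral_dominated_convergence[OF _ _ w(1)])
    show "AE x in ?M. (\<lambda>n. (cmod (f x - u n x))\<^sup>2) \<longlonglongrightarrow> 0"
      using lim
    proof eventually_elim
      case (elim x)
      then have "(\<lambda>n. (cmod (f x - u n x))\<^sup>2) \<longlonglongrightarrow> (cmod (f x - f x))\<^sup>2"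
        by (intro tendsto_intros)
      then show ?case by simp
    qed
  qed (use w(2) in auto)
  then have "\<forall>\<^sub>F n in sequentially. (LINT x|?M. (cmod (f x - u n x))\<^sup>2) < e\<^sup>2"
    using e by (intro order_tendstoD) auto
  then show ?thesis
    using that e by (auto simp: L2_norm_less_iff eventually_sequentially)
qed

lemma L2_approx_bounded:
  assumes f: "f \<in> L2" and e: "e > 0"
  obtains g B where "g \<in> borel_measurable (lebesgue_on {0..1})" "\<And>x. cmod (g x) \<le> B"
    "L2_norm (\<lambda>x. f x - g x) < e"
proof -
  have [measurable]: "f \<in> borel_measurable (lebesgue_on {0..1})"
    using f by (simp add: L2_def)
  \<comment> \<open>Truncation at height \<open>n\<close>. The error at each point is
    \<open>f x\<close> or 0, so its square is dominated by that of \<open>f\<close>.\<close>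
  define u where "u n x = (if cmod (f x) \<le> real n then f x else 0)" for n x
  have u[measurable]: "u n \<in> borel_measurable (lebesgue_on {0..1})" for n
    unfolding u_def by measurable
  have "(\<lambda>n. u n x) \<longlonglongrightarrow> f x" for x
  proof (rule tendsto_eventually)
    obtain N where "cmod (f x) \<le> real N" using real_arch_simple by blast
    then show "\<forall>\<^sub>F n in sequentially. u n x = f x"
      by (auto simp: u_def eventually_sequentially intro!: exI[of _ N])
  qed
  moreover have "integrable (lebesgue_on {0..1}) (\<lambda>x. (cmod (f x))\<^sup>2)"
    using f by (simp add: L2_def)
  ultimately obtain n where "L2_norm (\<lambda>x. f x - u n x) < e"
    using e by (elim L2_norm_dominated[rotated 3, where u = u and f = f]) (auto simp: u_def)
  moreover have "cmod (u n x) \<le> real n" for x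
    by (simp add: u_def)
  ultimately show ?thesis
    using that u by blast
qed

text \<open>Measurability provides continuous functions converging to \<open>g\<close> almost
  everywhere, but without control of their size or endpoint values. Clamping gives a constant
  dominating function, and a cutoff makes both endpoint values 0.\<close>

lemma L2_approx_continuous_periodic:
  assumes g: "g \<in> borel_measurable (lebesgue_on {0..1})" and B: "\<And>x. cmod (g x) \<le> B" and e: "e > 0"
  obtains h where "continuous_on UNIV h" "h 0 = h 1" "L2_norm (\<lambda>x. g x - h x) < e"
proof -
  let ?M = "lebesgue_on {0..1::real}"
  have "g measurable_on {0..1}"
    using g by (subst measurable_on_iff_borel_measurable) auto
  then obtain N v where N: "negligible N" and v: "\<And>n. continuous_on UNIV (v n)"
    and lim: "\<And>x. x \<notin> N \<Longrightarrow> (\<lambda>n. v n x) \<longlonglongrightarrow> (if x \<in> {0..1} then g x else 0)"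
    unfolding measurable_on_def by blast
  \<comment> \<open>The maximum with 1 keeps the divisor in \<open>clamp\<close> positive even when
    \<open>B = 0\<close>.\<close>
  define C where "C = max B 1"
  \<comment> \<open>The radial retraction onto the closed disc of radius \<open>C\<close>; it fixes
    every value of \<open>g\<close>.\<close>
  define clamp :: "complex \<Rightarrow> complex" where "clamp w = of_real (C / max C (cmod w)) * w" for w
  \<comment> \<open>A cutoff vanishing at 0 and 1 and equal to 1 from some \<open>n\<close> on at
    each interior point. The endpoints therefore join the exceptional null set.\<close>
  define \<phi> :: "nat \<Rightarrow> real \<Rightarrow> real" where "\<phi> n x = min 1 (real n * max 0 (x * (1 - x)))" for n x
  define u where "u n x = of_real (\<phi> n x) * clamp (v n x)" for n x
  have C: "C > 0" by (simp add: C_def)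
  have cont_clamp: "continuous_on UNIV clamp"
    unfolding clamp_def using C by (intro continuous_intros) (auto simp: max_def)
  have norm_clamp: "cmod (clamp w) \<le> C" for w
  proof -
    have "cmod w \<le> max C (cmod w)" "max C (cmod w) > 0" using C by auto
    then have "C * cmod w / max C (cmod w) \<le> C"
      using C by (simp add: divide_le_eq)
    then show ?thesis
      using C by (simp add: clamp_def norm_mult norm_divide)
  qed
  have clamp_id: "clamp w = w" if "cmod w \<le> B" for w
  proof -
    have "max C (cmod w) = C" using that by (simp add: C_def)
    then show ?thesis using C by (simp add: clamp_def)
  qed
  have cont_u: "continuous_on UNIV (u n)" for n
    unfolding u_def \<phi>_def
    by (intro continuous_intros continuous_on_compose2[OF cont_clamp v]) auto
  have norm_u: "cmod (u n x) \<le> C" for n x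
  proof -
    have "\<bar>\<phi> n x\<bar> * cmod (clamp (v n x)) \<le> 1 * C"
      by (intro mult_mono norm_clamp) (auto simp: \<phi>_def)
    then show ?thesis by (simp add: u_def norm_mult)
  qed
  have u_lim: "(\<lambda>n. u n x) \<longlonglongrightarrow> g x" if x: "x \<in> {0..1}" "x \<notin> N \<union> {0, 1}" for x
  proof -
    have "x * (1 - x) > 0" using x by auto
    then obtain n0 where n0: "1 < real n0 * (x * (1 - x))"
      using reals_Archimedean3 by blast
    have "\<phi> n x = 1" if "n \<ge> n0" for n
    proof -
      have "real n0 * (x * (1 - x)) \<le> real n * (x * (1 - x))"
        using that \<open>x * (1 - x) > 0\<close> by (intro mult_right_mono) auto
      then show ?thesis using n0 \<open>x * (1 - x) > 0\<close> by (simp add: \<phi>_def max_def)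
    qed
    then have "(\<lambda>n. \<phi> n x) \<longlonglongrightarrow> 1"
      by (intro tendsto_eventually) (auto simp: eventually_sequentially)
    moreover have "(\<lambda>n. clamp (v n x)) \<longlonglongrightarrow> clamp (g x)"
      using lim[of x] x cont_clamp
      by (intro isCont_tendsto_compose[of _ clamp]) (auto simp: continuous_on_eq_continuous_at)
    ultimately have "(\<lambda>n. u n x) \<longlonglongrightarrow> of_real 1 * clamp (g x)"
      unfolding u_def by (intro tendsto_intros)
    then show ?thesis using clamp_id[OF B] by simp
  qed
  have "AE x in ?M. (\<lambda>n. u n x) \<longlonglongrightarrow> g x"
  proof -
    have "negligible (N \<union> {0, 1})" using N by (intro negligible_Un) auto
    then have "N \<union> {0, 1} \<in> null_sets lebesgue" by (simp only: negligible_iff_null_sets)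
    then have "AE x in lebesgue. x \<notin> N \<union> {0, 1}" by (rule AE_not_in)
    then have "AE x in ?M. x \<notin> N \<union> {0, 1}"
      by (subst AE_restrict_space_iff) auto
    then show ?thesis
      using AE_space by eventually_elim (use u_lim in auto)
  qed
  moreover have "u n \<in> borel_measurable ?M" for n
    by (intro borel_measurable_integrable continuous_imp_integrable_real
        continuous_on_subset[OF cont_u]) auto
  moreover have "(cmod (g x - u n x))\<^sup>2 \<le> (B + C)\<^sup>2" for n x
    using norm_triangle_ineq4[of "g x" "u n x"] B[of x] norm_u[of n x] by (intro power_mono) auto
  moreover have "integrable ?M (\<lambda>x. (B + C)\<^sup>2)"
    by (intro continuous_imp_integrable_real continuous_intros)
  ultimately obtain n where "L2_norm (\<lambda>x. g x - u n x) < e"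
    using g e by (elim L2_norm_dominated[rotated 3, where u = u and f = g]) auto
  moreover have "u n 0 = u n 1" for n
    by (simp add: u_def \<phi>_def)
  ultimately show ?thesis
    using that cont_u by blast
qed

lemma trig_L2_approx:
  assumes f: "f \<in> L2" and e: "e > 0"
  obtains p where "p \<in> lin_combs trig_char" "L2_norm (\<lambda>x. f x - p x) < e"
proof -
  obtain g B where g: "g \<in> borel_measurable (lebesgue_on {0..1})" "\<And>x. cmod (g x) \<le> B"
    and fg: "L2_norm (\<lambda>x. f x - g x) < e / 2"
    using L2_approx_bounded[OF f, of "e / 2"] e by auto
  obtain h where h: "continuous_on UNIV h" "h 0 = h 1" and gh: "L2_norm (\<lambda>x. g x - h x) < e / 2 / 2"
    using L2_approx_continuous_periodic[OF g, of "e / 2 / 2"] e by auto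
  obtain p where p: "p \<in> lin_combs trig_char"
    \<comment> \<open>Integrating this pointwise bound over an interval of length 1 gives only a
      weak inequality; \<open>e / 6\<close> instead of \<open>e / 4\<close> restores
      strictness.\<close>
    and hp: "\<And>x. x \<in> {0..1} \<Longrightarrow> cmod (h x - p x) < e / 2 / 3"
    using trig_uniform_approx[of h "e / 2 / 3"] continuous_on_subset[OF h(1)] h(2) e by auto
  have gL2: "g \<in> L2" by (rule bounded_imp_L2) (fact g)+
  have hL2: "h \<in> L2" by (rule continuous_imp_L2) (rule continuous_on_subset[OF h(1)], simp)
  have pL2: "p \<in> L2"
    by (intro continuous_imp_L2 continuous_on_lin_combs[OF p] continuous_on_trig_char)
  have "(LINT x|lebesgue_on {0..1}. (cmod (h x - p x))\<^sup>2) \<le> (LINT x|lebesgue_on {0..1::real}. (e / 2 / 3)\<^sup>2)"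
  proof (rule integral_mono)
    show "integrable (lebesgue_on {0..1}) (\<lambda>x. (cmod (h x - p x))\<^sup>2)"
      using L2_diff[OF hL2 pL2] by (simp add: L2_def)
    show "integrable (lebesgue_on {0..1::real}) (\<lambda>x. (e / 2 / 3)\<^sup>2)"
      by (intro continuous_imp_integrable_real continuous_intros)
    show "(cmod (h x - p x))\<^sup>2 \<le> (e / 2 / 3)\<^sup>2" if "x \<in> space (lebesgue_on {0..1})" for x
      using hp[of x] that by (intro power_mono) auto
  qed
  also have "\<dots> < (e / 2 / 2)\<^sup>2"
    using e by (simp add: power_divide measure_restrict_space)
  finally have "L2_norm (\<lambda>x. h x - p x) < e / 2 / 2"
    using e by (subst L2_norm_less_iff) auto
  then have "L2_norm (\<lambda>x. (g x - h x) + (h x - p x)) < e / 2"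
    using gh e by (intro L2_norm_add_less L2_diff gL2 hL2 pL2) auto
  then have "L2_norm (\<lambda>x. (f x - g x) + (g x - p x)) < e"
    using fg e by (intro L2_norm_add_less L2_diff f gL2 pL2) auto
  then show ?thesis
    using that[OF p] by simp
qed

section \<open>Completeness of the system\<close>

lemma complete_L2_if_trig_char:
  assumes "\<And>k. trig_char k \<in> lin_combs e"
  shows "complete_L2 e"
  unfolding complete_L2_def
proof (intro ballI allI impI)
  fix f and \<epsilon> :: real
  assume "f \<in> L2" "\<epsilon> > 0"
  then obtain p where p: "p \<in> lin_combs trig_char" "L2_norm (\<lambda>x. f x - p x) < \<epsilon>"
    by (rule trig_L2_approx)
  have "p \<in> lin_combs e"
    by (rule lin_combs_trans[OF p(1) assms])
  then show "\<exists>F c. finite F \<and> L2_norm (\<lambda>x. f x - (\<Sum>k\<in>F. c k * e k x)) < \<epsilon>"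
    using p(2) by (auto simp: lin_combs_def)
qed

lemma lacunary_in_lin_combs:
  assumes a: "\<bar>a\<bar> < 1"
  shows "lacunary a k \<in> lin_combs (e_tilde a)"
\<comment> \<open>For even \<open>k = 2 * j \<noteq> 0\<close> the relation
  \<open>S k = e k + a * S j\<close> halves the index. Odd \<open>k\<close> and \<open>k = 0\<close>
  are the base cases, where \<open>S k\<close> is a multiple of \<open>e k\<close>.\<close>
proof (induction "nat \<bar>k\<bar>" arbitrary: k rule: less_induct)
  case less
  consider "k = 0" | "odd k" | j where "k = 2 * j" "k \<noteq> 0"
    by (cases "k = 0"; cases "even k") (auto elim: evenE)
  then show ?case
  proof cases
    case 1
    have "a \<noteq> 1"
      using a by auto
    then have "lacunary a 0 = (\<lambda>x. 1 / (1 - of_real a) * e_tilde a 0 x)"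
      using e_tilde_even[OF a, of 0] by (simp add: fun_eq_iff field_simps)
    then show ?thesis
      using 1 by (simp only:) (intro lin_combs_scale lin_combs_basis)
  next
    case 2
    have "sqrt (1 - a\<^sup>2) \<noteq> 0"
      using a by (simp add: abs_square_eq_1)
    then have "lacunary a k = (\<lambda>x. 1 / of_real (sqrt (1 - a\<^sup>2)) * e_tilde a k x)"
      by (simp add: e_tilde_odd[OF a 2] del: real_sqrt_eq_zero_cancel_iff)
    then show ?thesis
      by (simp only:) (intro lin_combs_scale lin_combs_basis)
  next
    case 3
    then have "lacunary a j \<in> lin_combs (e_tilde a)"
      by (intro less) auto
    moreover have "lacunary a k = (\<lambda>x. e_tilde a k x + of_real a * lacunary a j x)"
      by (simp add: 3 e_tilde_even[OF a])
    ultimately show ?thesis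
      by (simp only:) (intro lin_combs_add lin_combs_scale lin_combs_basis)
  qed
qed

theorem theorem2p3:
  fixes a :: real
  assumes "0 \<le> a" and "a < 1"
  shows "orthonormal_basis_L2 (e_tilde a)"
proof -
  have a: "\<bar>a\<bar> < 1" using assms by simp
  have "trig_char k \<in> lin_combs (e_tilde a)" for k
    unfolding trig_char_conv_lacunary[OF a]
    by (intro lin_combs_add lin_combs_scale lacunary_in_lin_combs a)
  then show ?thesis
    by (simp add: orthonormal_basis_L2_def orthonormal_e_tilde a complete_L2_if_trig_char)
qed

end
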